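(* Let $\lambda\in\mathbb R$ and let $\gamma(t)=\Psi(u(t),v(t))$, $t\in[a,b]$, be a smooth non-degenerate curve in $(\mathbb S_1^2)_{xz}^+=\{(x,y,z)\in\mathbb S_1^2:y>0\}$. Let $d_{xz}(t)$ be the distance of $\gamma(t)$ to the plane $\Pi_{xz}=\{y=0\}$, let $\mathbf n$ be the principal normal vector of $\gamma$, let $Y=\partial_y$, and assume $d_{xz}(t)+\lambda\neq0$ for all $t$. Then $\gamma$ is a catenary with respect to $\Pi_{xz}$ (with Lagrange multiplier $\lambda$) if and only if its curvature $\kappa$ satisfies $$\kappa(t)=-\frac{\langle\mathbf n(t),Y\rangle}{d_{xz}(t)+\lambda}.$$
   Context: $\mathbb L^3$ is $\mathbb R^3$ with the metric $\langle\,,\rangle=(dx)^2+(dy)^2-(dz)^2$, and $\mathbb S_1^2=\{(x,y,z):x^2+y^2-z^2=1\}$ with the induced metric, parametrized by $\Psi\colon\mathbb R^2\to\mathbb S_1^2$, $\Psi(u,v)=(\cosh(u)\cos v,\cosh(u)\sin v,\sinh(u))$. A curve $\gamma$ is non-degenerate if it is spacelike ($\langle\gamma',\gamma'\rangle>0$ everywhere; $\epsilon=1$) or timelike ($\langle\gamma',\gamma'\rangle<0$ everywhere; $\epsilon=-1$). For $\gamma(t)=\Psi(u(t),v(t))$ one has $|\gamma'|=\sqrt{\epsilon\langle\gamma',\gamma'\rangle}=\sqrt{\epsilon(v'^2\cosh(u)^2-u'^2)}$. With $\xi(p)=-p$ and $\times$ the Lorentzian cross product, $\langle a\times b,c\rangle=\det(a,b,c)$,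 the (geodesic) curvature of $\gamma$ in $\mathbb S_1^2$ is $\kappa=\epsilon\,\dfrac{\langle\gamma'',\gamma'\times\xi(\gamma)\rangle}{|\gamma'|^3}=\epsilon\,\dfrac{\det(\gamma,\gamma',\gamma'')}{|\gamma'|^3}$, and the principal normal vector is $\mathbf n=\dfrac{\xi(\gamma)\times\gamma'}{|\gamma'|}=-\dfrac{\gamma\times\gamma'}{|\gamma'|}$. The distance of a point $(x,y,z)\in(\mathbb S_1^2)_{xz}^+$ to $\Pi_{xz}$ is $y$, so $d_{xz}(t)=\cosh u(t)\sin v(t)$. A catenary with respect to $\Pi_{xz}$ with Lagrange multiplier $\lambda$ is a critical point, among curves in $(\mathbb S_1^2)_{xz}^+$ with the same endpoints, of $$\mathcal E_{xz}[\gamma]=\int_a^b(\cosh(u)\sin(v)+\lambda)\sqrt{\epsilon(v'^2\cosh(u)^2-u'^2)}\,dt,$$ i.e. a solution of its Euler-Lagrange equations. *)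

theory Defs
  imports "HOL-Analysis.Analysis"
begin

text \<open>Lorentz-Minkowski space is \<open>real ^ 3\<close>, with coordinates \<open>x = p $ 1\<close>, \<open>y = p $ 2\<close>, \<open>z = p $ 3\<close>.\<close>

definition linner :: "real ^ 3 \<Rightarrow> real ^ 3 \<Rightarrow> real" where
  "linner p q = p $ 1 * q $ 1 + p $ 2 * q $ 2 - p $ 3 * q $ 3"

definition lcross :: "real ^ 3 \<Rightarrow> real ^ 3 \<Rightarrow> real ^ 3" where
  "lcross p q = vector [cross3 p q $ 1, cross3 p q $ 2, - (cross3 p q $ 3)]"

lemma linner_lcross: "linner (lcross p q) r = det (vector [p, q, r])"
  by (simp add: linner_def lcross_def cross3_simps)

definition dS2 :: "(real ^ 3) set" where
  "dS2 = {p. (p $ 1)\<^sup>2 + (p $ 2)\<^sup>2 - (p $ 3)\<^sup>2 = 1}"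

definition dS2_xz_pos :: "(real ^ 3) set" where
  "dS2_xz_pos = {p \<in> dS2. p $ 2 > 0}"

definition Psi :: "real \<Rightarrow> real \<Rightarrow> real ^ 3" where
  "Psi u v = vector [cosh u * cos v, cosh u * sin v, sinh u]"

lemma Psi_in_dS2: "Psi u v \<in> dS2"
proof -
  have "(cosh u * cos v)\<^sup>2 + (cosh u * sin v)\<^sup>2 = (cosh u)\<^sup>2"
    by (simp add: power_mult_distrib flip: distrib_left)
  then show ?thesis
    by (simp add: Psi_def dS2_def cosh_square_eq)
qed

text \<open>The distance to the plane \<open>y = 0\<close>; it is used only on \<^const>\<open>dS2_xz_pos\<close>,
  where \<open>y > 0\<close>.\<close>

definition dist_xz :: "real ^ 3 \<Rightarrow> real" where
  "dist_xz p = p $ 2"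

definition Yvec :: "real ^ 3" where
  "Yvec = axis 2 1"

text \<open>Derivatives are taken within \<open>{a..b}\<close>, hence one-sided at the end points, so that
  nothing depends on the values of a function outside \<open>{a..b}\<close>.\<close>

definition D :: "real \<Rightarrow> real \<Rightarrow> (real \<Rightarrow> 'a::real_normed_vector) \<Rightarrow> real \<Rightarrow> 'a" where
  "D a b f t = vector_derivative f (at t within {a..b})"

definition smooth :: "real \<Rightarrow> real \<Rightarrow> (real \<Rightarrow> 'a::real_normed_vector) \<Rightarrow> bool" where
  "smooth a b f \<longleftrightarrow> (\<forall>k. \<forall>t\<in>{a..b}. ((D a b ^^ k) f) differentiable (at t within {a..b}))"

definition spacelike :: "real \<Rightarrow> real \<Rightarrow> (real \<Rightarrow> real ^ 3) \<Rightarrow> bool" where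
  "spacelike a b \<gamma> \<longleftrightarrow> (\<forall>t\<in>{a..b}. linner (D a b \<gamma> t) (D a b \<gamma> t) > 0)"

definition timelike :: "real \<Rightarrow> real \<Rightarrow> (real \<Rightarrow> real ^ 3) \<Rightarrow> bool" where
  "timelike a b \<gamma> \<longleftrightarrow> (\<forall>t\<in>{a..b}. linner (D a b \<gamma> t) (D a b \<gamma> t) < 0)"

definition nondegenerate :: "real \<Rightarrow> real \<Rightarrow> (real \<Rightarrow> real ^ 3) \<Rightarrow> bool" where
  "nondegenerate a b \<gamma> \<longleftrightarrow> spacelike a b \<gamma> \<or> timelike a b \<gamma>"

text \<open>The sign \<open>\<epsilon>\<close> of a non-degenerate curve.\<close>

definition causal_sign :: "real \<Rightarrow> real \<Rightarrow> (real \<Rightarrow> real ^ 3) \<Rightarrow> real" where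
  "causal_sign a b \<gamma> = (if spacelike a b \<gamma> then 1 else - 1)"

definition speed :: "real \<Rightarrow> real \<Rightarrow> (real \<Rightarrow> real ^ 3) \<Rightarrow> real \<Rightarrow> real" where
  "speed a b \<gamma> t = sqrt (causal_sign a b \<gamma> * linner (D a b \<gamma> t) (D a b \<gamma> t))"

definition xi :: "real ^ 3 \<Rightarrow> real ^ 3" where
  "xi p = - p"

definition curvature :: "real \<Rightarrow> real \<Rightarrow> (real \<Rightarrow> real ^ 3) \<Rightarrow> real \<Rightarrow> real" where
  "curvature a b \<gamma> t =
     causal_sign a b \<gamma> *
     (linner (D a b (D a b \<gamma>) t) (lcross (D a b \<gamma> t) (xi (\<gamma> t))) / speed a b \<gamma> t ^ 3)"

definition principal_normal :: "real \<Rightarrow> real \<Rightarrow> (real \<Rightarrow> real ^ 3) \<Rightarrow> real \<Rightarrow> real ^ 3" where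
  "principal_normal a b \<gamma> t = (1 / speed a b \<gamma> t) *\<^sub>R lcross (xi (\<gamma> t)) (D a b \<gamma> t)"

definition energy_xz ::
  "real \<Rightarrow> real \<Rightarrow> real \<Rightarrow> real \<Rightarrow> (real \<Rightarrow> real) \<Rightarrow> (real \<Rightarrow> real) \<Rightarrow> real" where
  "energy_xz \<epsilon> lam a b u v =
     integral {a..b} (\<lambda>t. (cosh (u t) * sin (v t) + lam) *
       sqrt (\<epsilon> * ((D a b v t)\<^sup>2 * (cosh (u t))\<^sup>2 - (D a b u t)\<^sup>2)))"

text \<open>Critical points: the first variation vanishes for all smooth variations
  \<open>(\<eta>, \<zeta>)\<close> of \<open>(u, v)\<close> fixing the end points. Only \<open>s\<close> near \<open>0\<close> matters; if \<open>\<gamma>\<close> is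
  non-degenerate and lies in \<^const>\<open>dS2_xz_pos\<close>, then by compactness the varied curves also lie
  there and have the same sign \<open>\<epsilon>\<close>, for all small \<open>s\<close>.\<close>

definition catenary_xz ::
  "real \<Rightarrow> real \<Rightarrow> real \<Rightarrow> (real \<Rightarrow> real) \<Rightarrow> (real \<Rightarrow> real) \<Rightarrow> bool" where
  "catenary_xz lam a b u v \<longleftrightarrow>
     (\<forall>\<eta> \<zeta>. smooth a b \<eta> \<and> smooth a b \<zeta> \<and> \<eta> a = 0 \<and> \<eta> b = 0 \<and> \<zeta> a = 0 \<and> \<zeta> b = 0 \<longrightarrow>
        ((\<lambda>s. energy_xz (causal_sign a b (\<lambda>t. Psi (u t) (v t))) lam a b
                 (\<lambda>t. u t + s * \<eta> t) (\<lambda>t. v t + s * \<zeta> t))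
           has_real_derivative 0) (at 0))"

end

theory Submission
  imports Defs
begin

text \<open>The first variation of the energy along \<open>(\<eta>, \<zeta>)\<close> is
  \<open>\<integral> cosh u \<cdot> K / |\<gamma>'|\<^sup>3 \<cdot> (v' \<eta> - u' \<zeta>)\<close>. Reparametrization invariance makes the two
  Euler-Lagrange expressions multiples of a single function \<open>K\<close>, a polynomial in \<open>cosh u\<close>,
  \<open>sinh u\<close>, \<open>sin v\<close>, \<open>cos v\<close> and the derivatives of \<open>u\<close>, \<open>v\<close>; its two summands are, up to
  nonzero factors, \<open>\<kappa> (d + \<lambda>)\<close> and \<open>\<langle>n, Y\<rangle>\<close>, so \<open>K = 0\<close> is the curvature equation. For the
  converse, no bump functions are needed: since \<open>K\<close> is smooth, one may test with
  \<open>(\<eta>, \<zeta>) = (t - a) (b - t) K (v', - u')\<close>, which turns the first variation into the integral of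
  a nonnegative function.\<close>

section \<open>Derivatives within a closed interval and smooth functions\<close>

lemma has_derivative_D:
  assumes "smooth a b f" "t \<in> {a..b}"
  shows "(f has_vector_derivative D a b f t) (at t within {a..b})"
proof -
  have "((D a b ^^ 0) f) differentiable (at t within {a..b})"
    using assms unfolding smooth_def by blast
  then show ?thesis
    by (simp add: D_def vector_derivative_works)
qed

lemma real_derivative_D:
  "smooth a b f \<Longrightarrow> t \<in> {a..b} \<Longrightarrow> (f has_real_derivative D a b f t) (at t within {a..b})"
  by (simp add: has_derivative_D has_real_derivative_iff_has_vector_derivative)

lemma D_eq:
  fixes f :: "real \<Rightarrow> 'a::euclidean_space"
  assumes "a < b" "t \<in> {a..b}" "(f has_vector_derivative f') (at t within {a..b})"
  shows "D a b f t = f'"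
  unfolding D_def by (rule vector_derivative_within_closed_interval[OF assms])

lemma smooth_D:
  assumes "smooth a b f"
  shows "smooth a b (D a b f)"
  using assms unfolding smooth_def funpow_swap1[symmetric]
  by (metis comp_apply funpow.simps(2))

lemma smooth_continuous_on:
  assumes "smooth a b f"
  shows "continuous_on {a..b} f"
  using has_derivative_D[OF assms] by (meson continuous_on_eq_continuous_within
      has_vector_derivative_continuous)

text \<open>Coinduction for smoothness: by induction on \<open>k\<close>, the \<open>k\<close>-th
  iterated derivative of \<open>f\<close> agrees on \<open>{a..b}\<close> with a member of
  \<open>S\<close>, and members of \<open>S\<close> are differentiable there. Agreement on
  \<open>{a..b}\<close> is enough because all derivatives are taken within this interval.\<close>

lemma smooth_coinduct:
  fixes f :: "real \<Rightarrow> 'a::euclidean_space"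
  assumes "a < b"
    and step: "\<And>f. f \<in> S \<Longrightarrow>
      \<exists>g\<in>S. \<forall>t\<in>{a..b}. (f has_vector_derivative g t) (at t within {a..b})"
    and "f \<in> S"
  shows "smooth a b f"
proof -
  have agree: "\<exists>g\<in>S. \<forall>t\<in>{a..b}. (D a b ^^ k) f t = g t" for k
  proof (induction k)
    case 0
    then show ?case using \<open>f \<in> S\<close> by auto
  next
    case (Suc k)
    then obtain g where g: "g \<in> S" "\<And>t. t \<in> {a..b} \<Longrightarrow> (D a b ^^ k) f t = g t" by blast
    from step[OF g(1)] obtain h where h: "h \<in> S"
      "\<And>t. t \<in> {a..b} \<Longrightarrow> (g has_vector_derivative h t) (at t within {a..b})" by blast
    have "(D a b ^^ Suc k) f t = h t" if "t \<in> {a..b}" for t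
      using D_eq[OF \<open>a < b\<close> that has_vector_derivative_transform[OF that g(2) h(2)[OF that]]]
      by simp
    with h(1) show ?case by blast
  qed
  show ?thesis
    unfolding smooth_def
  proof (intro allI ballI)
    fix k t assume t: "t \<in> {a..b}"
    obtain g where g: "g \<in> S" "\<And>t. t \<in> {a..b} \<Longrightarrow> (D a b ^^ k) f t = g t"
      using agree[of k] by blast
    from step[OF g(1)] obtain h where
      "(g has_vector_derivative h) (at t within {a..b})" using t by blast
    from has_vector_derivative_transform[OF t g(2) this]
    show "((D a b ^^ k) f) differentiable (at t within {a..b})"
      by (rule differentiableI_vector)
  qed
qed

text \<open>A class of expressions over smooth functions that is closed under differentiation up to
  equality on \<open>{a..b}\<close>, so that \<open>smooth_coinduct\<close> applies to it. It is
  rich enough for \<open>euler_lagrange\<close> and for the test functions built from it.\<close>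

inductive_set smooth_closure :: "real \<Rightarrow> real \<Rightarrow> (real \<Rightarrow> real) set" for a b where
  base: "smooth a b f \<Longrightarrow> f \<in> smooth_closure a b"
| const: "(\<lambda>t. k) \<in> smooth_closure a b"
| ident: "(\<lambda>t. t) \<in> smooth_closure a b"
| add: "f \<in> smooth_closure a b \<Longrightarrow> g \<in> smooth_closure a b \<Longrightarrow>
    (\<lambda>t. f t + g t) \<in> smooth_closure a b"
| diff: "f \<in> smooth_closure a b \<Longrightarrow> g \<in> smooth_closure a b \<Longrightarrow>
    (\<lambda>t. f t - g t) \<in> smooth_closure a b"
| mult: "f \<in> smooth_closure a b \<Longrightarrow> g \<in> smooth_closure a b \<Longrightarrow>
    (\<lambda>t. f t * g t) \<in> smooth_closure a b"
| sin: "f \<in> smooth_closure a b \<Longrightarrow> (\<lambda>t. sin (f t)) \<in> smooth_closure a b"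
| cos: "f \<in> smooth_closure a b \<Longrightarrow> (\<lambda>t. cos (f t)) \<in> smooth_closure a b"
| sinh: "f \<in> smooth_closure a b \<Longrightarrow> (\<lambda>t. sinh (f t)) \<in> smooth_closure a b"
| cosh: "f \<in> smooth_closure a b \<Longrightarrow> (\<lambda>t. cosh (f t)) \<in> smooth_closure a b"

lemma smooth_closure_derivative:
  assumes "f \<in> smooth_closure a b"
  shows "\<exists>g\<in>smooth_closure a b. \<forall>t\<in>{a..b}. (f has_real_derivative g t) (at t within {a..b})"
  using assms
proof induction
  case (base f)
  then show ?case
    using has_derivative_D[of a b f] smooth_D smooth_closure.base
    by (metis has_real_derivative_iff_has_vector_derivative)
next
  case (const k)
  show ?case by (rule bexI[OF _ smooth_closure.const[of 0]]) auto
next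
  case ident
  show ?case by (rule bexI[OF _ smooth_closure.const[of 1]]) (auto intro!: derivative_eq_intros)
next
  case (add f g)
  then obtain f' g' where "f' \<in> smooth_closure a b" "g' \<in> smooth_closure a b"
    "\<forall>t\<in>{a..b}. (f has_real_derivative f' t) (at t within {a..b})"
    "\<forall>t\<in>{a..b}. (g has_real_derivative g' t) (at t within {a..b})" by blast
  then show ?case
    by (intro bexI[where x = "\<lambda>t. f' t + g' t"])
      (auto intro!: derivative_eq_intros smooth_closure.intros(2-))
next
  case (diff f g)
  then obtain f' g' where "f' \<in> smooth_closure a b" "g' \<in> smooth_closure a b"
    "\<forall>t\<in>{a..b}. (f has_real_derivative f' t) (at t within {a..b})"
    "\<forall>t\<in>{a..b}. (g has_real_derivative g' t) (at t within {a..b})" by blast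
  then show ?case
    by (intro bexI[where x = "\<lambda>t. f' t - g' t"])
      (auto intro!: derivative_eq_intros smooth_closure.intros(2-))
next
  case (mult f g)
  then obtain f' g' where "f' \<in> smooth_closure a b" "g' \<in> smooth_closure a b"
    "\<forall>t\<in>{a..b}. (f has_real_derivative f' t) (at t within {a..b})"
    "\<forall>t\<in>{a..b}. (g has_real_derivative g' t) (at t within {a..b})" by blast
  with mult.hyps show ?case
    by (intro bexI[where x = "\<lambda>t. f' t * g t + g' t * f t"])
      (auto intro!: derivative_eq_intros smooth_closure.add smooth_closure.mult)
next
  case (sin f)
  then obtain f' where "f' \<in> smooth_closure a b"
    "\<forall>t\<in>{a..b}. (f has_real_derivative f' t) (at t within {a..b})" by blast
  with sin.hyps show ?case
    by (intro bexI[where x = "\<lambda>t. cos (f t) * f' t"])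
      (auto intro!: derivative_eq_intros smooth_closure.intros(2-))
next
  case (cos f)
  then obtain f' where "f' \<in> smooth_closure a b"
    "\<forall>t\<in>{a..b}. (f has_real_derivative f' t) (at t within {a..b})" by blast
  with cos.hyps show ?case
    by (intro bexI[where x = "\<lambda>t. (- 1) * (sin (f t) * f' t)"] smooth_closure.mult
        smooth_closure.const smooth_closure.sin) (auto intro!: derivative_eq_intros)
next
  case (sinh f)
  then obtain f' where "f' \<in> smooth_closure a b"
    "\<forall>t\<in>{a..b}. (f has_real_derivative f' t) (at t within {a..b})" by blast
  with sinh.hyps show ?case
    by (intro bexI[where x = "\<lambda>t. cosh (f t) * f' t"])
      (auto intro!: derivative_eq_intros smooth_closure.intros(2-))
next
  case (cosh f)
  then obtain f' where "f' \<in> smooth_closure a b"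
    "\<forall>t\<in>{a..b}. (f has_real_derivative f' t) (at t within {a..b})" by blast
  with cosh.hyps show ?case
    by (intro bexI[where x = "\<lambda>t. sinh (f t) * f' t"])
      (auto intro!: derivative_eq_intros smooth_closure.intros(2-))
qed

lemma smooth_closure_smooth:
  assumes "a < b" "f \<in> smooth_closure a b"
  shows "smooth a b f"
  using assms smooth_closure_derivative
  by (intro smooth_coinduct[where S = "smooth_closure a b"])
    (auto simp: has_real_derivative_iff_has_vector_derivative)

section \<open>Uniform positivity for small parameters\<close>

text \<open>A tube argument: the points where positivity fails form a compact set, so its projection
  to the parameter axis is closed; it misses 0, hence a ball around 0. This keeps the radicand of
  the energy positive along small variations.\<close>

lemma eventually_positive_on_compact:
  fixes G :: "real \<times> real \<Rightarrow> real"
  assumes cont: "continuous_on (UNIV \<times> {a..b}) G"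
    and pos: "\<And>t. t \<in> {a..b} \<Longrightarrow> G (0, t) > 0"
  obtains d where "d > 0" "\<And>s t :: real. s \<in> ball 0 d \<Longrightarrow> t \<in> {a..b} \<Longrightarrow> G (s, t) > 0"
proof -
  \<comment> \<open>Cutting the parameter down to \<open>{-1..1}\<close> makes the set of failures
    compact; this is why the radius is \<open>min d 1\<close> below.\<close>
  let ?Z = "({-1..1} \<times> {a..b}) \<inter> G -` {..0}"
  have "continuous_on ({-1..1} \<times> {a..b}) G"
    by (rule continuous_on_subset[OF cont]) auto
  then have "closed ?Z"
    by (intro continuous_closed_preimage closed_Times) auto
  then have "compact (({-1..1} \<times> {a..b}) \<inter> ?Z)"
    by (intro compact_Int_closed compact_Times) auto
  then have "compact ?Z" by (simp add: Int_absorb1 flip: Int_assoc)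
  then have "closed (fst ` (?Z))"
    by (intro compact_imp_closed compact_continuous_image continuous_intros)
  moreover have "0 \<notin> fst ` (?Z)"
    using pos by force
  ultimately obtain d where d: "d > 0" "ball 0 d \<inter> fst ` (?Z) = {}"
    by (metis closed_def ComplI disjoint_eq_subset_Compl open_contains_ball)
  show thesis
  proof
    show "min d 1 > 0" using d by simp
    fix s t :: real assume st: "s \<in> ball 0 (min d 1)" "t \<in> {a..b}"
    show "G (s, t) > 0"
    proof (rule ccontr)
      assume "\<not> G (s, t) > 0"
      with st have "(s, t) \<in> ?Z" by auto
      then have "s \<in> fst ` (?Z)" by force
      moreover have "s \<in> ball 0 d" using st by auto
      ultimately show False using d(2) by blast
    qed
  qed
qed

section \<open>Derivatives of the parametrization and of the terms of the Lagrangian\<close>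

lemma has_vector_derivative_vector3:
  fixes f g h :: "real \<Rightarrow> real"
  assumes "(f has_real_derivative f') F" "(g has_real_derivative g') F"
    "(h has_real_derivative h') F"
  shows "((\<lambda>t. vector [f t, g t, h t] :: real ^ 3) has_vector_derivative vector [f', g', h']) F"
proof -
  have *: "(vector [x, y, z] :: real ^ 3) = x *\<^sub>R axis 1 1 + y *\<^sub>R axis 2 1 + z *\<^sub>R axis 3 1"
    for x y z
    by (simp add: vec_eq_iff forall_3 axis_def)
  have "((\<lambda>t. k t *\<^sub>R e) has_vector_derivative k' *\<^sub>R e) F"
    if "(k has_real_derivative k') F" for k k' and e :: "real ^ 3"
    using that unfolding has_real_derivative_iff_has_vector_derivative
    by (rule bounded_linear.has_vector_derivative[OF bounded_linear_scaleR_left])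
  with assms show ?thesis
    unfolding * by (intro has_vector_derivative_add)
qed

lemma D_Psi:
  assumes "a < b" "smooth a b u" "smooth a b v" "t \<in> {a..b}"
  shows "D a b (\<lambda>t. Psi (u t) (v t)) t =
    vector [sinh (u t) * D a b u t * cos (v t) - cosh (u t) * sin (v t) * D a b v t,
      sinh (u t) * D a b u t * sin (v t) + cosh (u t) * cos (v t) * D a b v t,
      cosh (u t) * D a b u t]"
proof -
  have "(u has_real_derivative D a b u t) (at t within {a..b})"
    "(v has_real_derivative D a b v t) (at t within {a..b})"
    using assms by (simp_all add: real_derivative_D)
  then show ?thesis
    unfolding Psi_def
    by (intro D_eq[OF assms(1,4)] has_vector_derivative_vector3) (auto intro!: derivative_eq_intros)
qed

text \<open>The first fundamental form of the surface in the coordinates \<open>u\<close>,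
  \<open>v\<close>. It links the intrinsic notion of speed with the radicand in
  \<open>energy_xz\<close>.\<close>

lemma linner_D_Psi:
  assumes "a < b" "smooth a b u" "smooth a b v" "t \<in> {a..b}"
  shows "linner (D a b (\<lambda>t. Psi (u t) (v t)) t) (D a b (\<lambda>t. Psi (u t) (v t)) t) =
    (D a b v t)\<^sup>2 * (cosh (u t))\<^sup>2 - (D a b u t)\<^sup>2"
  unfolding D_Psi[OF assms] linner_def vector_3
  using sin_cos_squared_add[of "v t"] cosh_square_eq[of "u t"] by algebra

lemma squares_derivative:
  fixes p q c :: "real \<Rightarrow> real"
  assumes "(p has_real_derivative p') (at t within S)" "(q has_real_derivative q') (at t within S)"
    "(c has_real_derivative c') (at t within S)"
  shows "((\<lambda>t. e * ((q t)\<^sup>2 * (c t)\<^sup>2 - (p t)\<^sup>2)) has_real_derivative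
    2 * (e * (q t * q' * (c t)\<^sup>2 + (q t)\<^sup>2 * c t * c' - p t * p'))) (at t within S)"
  by (auto intro!: derivative_eq_intros assms simp: algebra_simps power2_eq_square)

text \<open>Stated for abstract functions; it is applied with \<open>F\<close> the weight,
  \<open>p\<close> and \<open>q\<close> the derivatives of \<open>u\<close> and \<open>v\<close>,
  \<open>c\<close> equal to \<open>cosh u\<close>, and \<open>x\<close>, \<open>y\<close> the two
  components of the variation.\<close>

lemma momentum_derivative:
  fixes F p q c x y :: "real \<Rightarrow> real"
  assumes "(F has_real_derivative F') (at t within S)"
    "(p has_real_derivative p') (at t within S)" "(q has_real_derivative q') (at t within S)"
    "(c has_real_derivative c') (at t within S)"
    "(x has_real_derivative x') (at t within S)" "(y has_real_derivative y') (at t within S)"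
  shows "((\<lambda>t. F t * e * (q t * (c t)\<^sup>2 * y t - p t * x t)) has_real_derivative
    e * (F' * (q t * (c t)\<^sup>2 * y t - p t * x t) + F t * (q' * (c t)\<^sup>2 * y t
      + 2 * q t * c t * c' * y t + q t * (c t)\<^sup>2 * y' - p' * x t - p t * x'))) (at t within S)"
  by (auto intro!: derivative_eq_intros assms simp: algebra_simps power2_eq_square)

lemma weight_derivative:
  fixes u v :: "real \<Rightarrow> real"
  assumes "(u has_real_derivative u') (at t within S)" "(v has_real_derivative v') (at t within S)"
  shows "((\<lambda>t. cosh (u t) * sin (v t) + k) has_real_derivative
    sinh (u t) * u' * sin (v t) + cosh (u t) * cos (v t) * v') (at t within S)"
  by (auto intro!: derivative_eq_intros assms)

lemma Psi_tangent_derivative: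
  fixes u v p q :: "real \<Rightarrow> real"
  assumes "(u has_real_derivative p t) (at t within S)" "(v has_real_derivative q t) (at t within S)"
    "(p has_real_derivative p') (at t within S)" "(q has_real_derivative q') (at t within S)"
  shows "((\<lambda>t. vector [sinh (u t) * p t * cos (v t) - cosh (u t) * sin (v t) * q t,
      sinh (u t) * p t * sin (v t) + cosh (u t) * cos (v t) * q t, cosh (u t) * p t] :: real ^ 3)
    has_vector_derivative
    vector [cosh (u t) * (p t)\<^sup>2 * cos (v t) + sinh (u t) * p' * cos (v t)
        - 2 * sinh (u t) * p t * sin (v t) * q t
        - cosh (u t) * cos (v t) * (q t)\<^sup>2 - cosh (u t) * sin (v t) * q',
      cosh (u t) * (p t)\<^sup>2 * sin (v t) + sinh (u t) * p' * sin (v t)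
        + 2 * sinh (u t) * p t * cos (v t) * q t
        - cosh (u t) * sin (v t) * (q t)\<^sup>2 + cosh (u t) * cos (v t) * q',
      sinh (u t) * (p t)\<^sup>2 + cosh (u t) * p']) (at t within S)"
  by (rule has_vector_derivative_vector3)
    (auto intro!: derivative_eq_intros assms simp: power2_eq_square algebra_simps)

section \<open>First variation of the energy\<close>

text \<open>The sign \<open>e\<close> treats spacelike and timelike curves at once: both cases
  become the single inequality \<open>pos\<close>, and the algebra uses only
  \<open>e * e = 1\<close>.\<close>

locale nondegenerate_lift =
  fixes a b lam e :: real and u v :: "real \<Rightarrow> real"
  assumes ab: "a < b" and smooth_u: "smooth a b u" and smooth_v: "smooth a b v"
    and sign: "e * e = 1"
    and pos: "\<And>t. t \<in> {a..b} \<Longrightarrow> e * ((D a b v t)\<^sup>2 * (cosh (u t))\<^sup>2 - (D a b u t)\<^sup>2) > 0"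
begin

abbreviation "u' \<equiv> D a b u"
abbreviation "v' \<equiv> D a b v"
abbreviation "u'' \<equiv> D a b (D a b u)"
abbreviation "v'' \<equiv> D a b (D a b v)"

text \<open>In terms of the curve, \<open>metric_sq\<close> is \<langle>\<gamma>',
  \<gamma>'\<rangle>, \<open>w\<close> is the speed and \<open>weight\<close> is the distance to the
  plane plus the multiplier.\<close>

definition "metric_sq t = (v' t)\<^sup>2 * (cosh (u t))\<^sup>2 - (u' t)\<^sup>2"
definition "w t = sqrt (e * metric_sq t)"
definition "weight t = cosh (u t) * sin (v t) + lam"
text \<open>\<open>curv_det\<close> is \<open>det (\<gamma>, \<gamma>', \<gamma>'')\<close> and \<open>normal_Y\<close> is \<open>|\<gamma>'| \<langle>n, Y\<rangle>\<close>;
  \<open>euler_lagrange\<close> is the function \<open>K\<close> of the introduction.\<close>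

definition "curv_det t = v' t ^ 3 * (cosh (u t))\<^sup>2 * sinh (u t)
  - 2 * (u' t)\<^sup>2 * v' t * sinh (u t) + (u'' t * v' t - u' t * v'' t) * cosh (u t)"
definition "normal_Y t = sinh (u t) * cosh (u t) * sin (v t) * v' t + cos (v t) * u' t"
definition "euler_lagrange t = weight t * curv_det t + metric_sq t * normal_Y t"

text \<open>The derivative at \<open>s = 0\<close> of the energy integrand along the variation: the
  first summand differentiates the weight, the second the speed.\<close>

definition "variation \<eta> \<zeta> t =
  (sinh (u t) * \<eta> t * sin (v t) + cosh (u t) * cos (v t) * \<zeta> t) * w t +
  weight t * (e * (v' t * D a b \<zeta> t * (cosh (u t))\<^sup>2 +
    (v' t)\<^sup>2 * cosh (u t) * sinh (u t) * \<eta> t - u' t * D a b \<eta> t) / w t)"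

lemma metric_sq_pos: "t \<in> {a..b} \<Longrightarrow> e * metric_sq t > 0"
  using pos by (simp add: metric_sq_def)

lemma w_pos: "t \<in> {a..b} \<Longrightarrow> w t > 0"
  using metric_sq_pos by (simp add: w_def)

lemma w_sq: "t \<in> {a..b} \<Longrightarrow> (w t)\<^sup>2 = e * metric_sq t"
  using metric_sq_pos[of t] by (simp add: w_def)

lemmas smooth_uv = smooth_u smooth_v smooth_D[OF smooth_u] smooth_D[OF smooth_v]
  smooth_D[OF smooth_D[OF smooth_u]] smooth_D[OF smooth_D[OF smooth_v]]

lemmas cont_uv = smooth_uv[THEN smooth_continuous_on]

lemma cont_w: "continuous_on {a..b} w"
  unfolding w_def metric_sq_def by (intro continuous_intros cont_uv)

lemma cont_euler_lagrange: "continuous_on {a..b} euler_lagrange"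
  unfolding euler_lagrange_def weight_def curv_det_def metric_sq_def normal_Y_def
  by (intro continuous_intros cont_uv)

lemma smooth_euler_lagrange: "smooth a b euler_lagrange"
proof -
  have "euler_lagrange \<in> smooth_closure a b"
    unfolding euler_lagrange_def weight_def curv_det_def metric_sq_def normal_Y_def
      \<comment> \<open>Powers are written as products, since \<open>smooth_closure\<close> has a
        rule for products only.\<close>
      power2_eq_square power3_eq_cube
    by (intro smooth_closure.intros(2-) smooth_uv[THEN smooth_closure.base])
  then show ?thesis by (rule smooth_closure_smooth[OF ab])
qed

text \<open>Integration by parts: \<open>weight * e * (v' * cosh\<^sup>2 u * \<zeta> - u' * \<eta>) / w\<close> is the momentum
  of the Lagrangian paired with the variation.\<close>

lemma variation_boundary_derivative:
  assumes \<eta>: "smooth a b \<eta>" and \<zeta>: "smooth a b \<zeta>" and t: "t \<in> {a..b}"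
  shows "((\<lambda>t. weight t * e * (v' t * (cosh (u t))\<^sup>2 * \<zeta> t - u' t * \<eta> t) / w t)
    has_real_derivative
    variation \<eta> \<zeta> t - cosh (u t) * euler_lagrange t / w t ^ 3 * (v' t * \<eta> t - u' t * \<zeta> t))
    (at t within {a..b})"
proof -
  note d = smooth_uv(1-4)[THEN real_derivative_D, OF t] \<eta>[THEN real_derivative_D, OF t]
    \<zeta>[THEN real_derivative_D, OF t]
  \<comment> \<open>Half the derivative of \<open>metric_sq\<close>, so that \<open>w\<close> has
    derivative \<open>e * M / w t\<close>.\<close>
  define M where "M = v' t * v'' t * (cosh (u t))\<^sup>2 + (v' t)\<^sup>2 * cosh (u t) * sinh (u t) * u' t
    - u' t * u'' t"
  have dc: "((\<lambda>t. cosh (u t)) has_real_derivative sinh (u t) * u' t) (at t within {a..b})"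
    by (rule has_field_derivative_cosh[OF d(1)])
  have dF: "(weight has_real_derivative
      sinh (u t) * u' t * sin (v t) + cosh (u t) * cos (v t) * v' t) (at t within {a..b})"
    unfolding weight_def[abs_def] by (rule weight_derivative[OF d(1,2)])
  have w: "w = (\<lambda>t. sqrt (e * metric_sq t))"
    by (rule ext) (rule w_def)
  have "((\<lambda>t. e * metric_sq t) has_real_derivative 2 * (e * M)) (at t within {a..b})"
    unfolding metric_sq_def M_def
    by (rule DERIV_cong[OF squares_derivative[OF d(3) d(4) dc]])
      (simp add: algebra_simps power2_eq_square)
  then have "(w has_real_derivative inverse (w t) / 2 * (2 * (e * M))) (at t within {a..b})"
    unfolding w
    by (rule DERIV_chain2[where g = "\<lambda>t. e * metric_sq t",
          OF DERIV_real_sqrt[OF metric_sq_pos[OF t]]])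
  then have dw: "(w has_real_derivative e * M / w t) (at t within {a..b})"
    using w_pos[OF t] by (elim DERIV_cong) (simp add: field_simps)
  \<comment> \<open>The momentum pairing is \<open>e * N / w t\<close>, and \<open>e * N'\<close> is
    the derivative of its numerator \<open>e * N\<close>.\<close>
  define N where "N = weight t * (v' t * (cosh (u t))\<^sup>2 * \<zeta> t - u' t * \<eta> t)"
  define N' where "N' =
    (sinh (u t) * u' t * sin (v t) + cosh (u t) * cos (v t) * v' t) *
      (v' t * (cosh (u t))\<^sup>2 * \<zeta> t - u' t * \<eta> t) +
    weight t * (v'' t * (cosh (u t))\<^sup>2 * \<zeta> t + 2 * v' t * cosh (u t) * (sinh (u t) * u' t) * \<zeta> t
      + v' t * (cosh (u t))\<^sup>2 * D a b \<zeta> t - u'' t * \<eta> t - u' t * D a b \<eta> t)"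
  have dN: "((\<lambda>t. weight t * e * (v' t * (cosh (u t))\<^sup>2 * \<zeta> t - u' t * \<eta> t))
    has_real_derivative e * N') (at t within {a..b})"
    unfolding N'_def by (rule momentum_derivative[OF dF d(3) d(4) dc d(5) d(6)])
  \<comment> \<open>The core of the computation: the numerator from the quotient rule, cleared of
    \<open>w\<close>, splits into the variation and a multiple of \<open>euler_lagrange\<close>. It
    is a polynomial identity in which \<open>sinh\<close>, \<open>cosh\<close>, \<open>sin\<close>
    and \<open>cos\<close> behave as independent variables.\<close>
  have poly: "N' * metric_sq t - N * M =
      (sinh (u t) * \<eta> t * sin (v t) + cosh (u t) * cos (v t) * \<zeta> t) * (metric_sq t)\<^sup>2
      + weight t * (v' t * D a b \<zeta> t * (cosh (u t))\<^sup>2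
        + (v' t)\<^sup>2 * cosh (u t) * sinh (u t) * \<eta> t - u' t * D a b \<eta> t) * metric_sq t
      - cosh (u t) * euler_lagrange t * (v' t * \<eta> t - u' t * \<zeta> t)"
    unfolding N'_def N_def M_def euler_lagrange_def curv_det_def normal_Y_def metric_sq_def
    by (simp add: algebra_simps power2_eq_square power3_eq_cube)
  have V: "metric_sq t = e * (w t)\<^sup>2"
    using w_sq[OF t] sign by (simp flip: mult.assoc)
  then have V2: "(metric_sq t)\<^sup>2 = (w t)\<^sup>2 * (w t)\<^sup>2"
    using sign by algebra
  \<comment> \<open>Since \<open>metric_sq t = e * (w t)\<^sup>2\<close> and
    \<open>e * e = 1\<close>, the signs cancel.\<close>
  have "e * N' * (w t)\<^sup>2 - e * (e * N * M) = N' * metric_sq t - N * M"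
    unfolding V using sign by algebra
  moreover have "(e * x * y - e * N * (e * M / y)) / (y * y) = (e * x * y\<^sup>2 - e * (e * N * M)) / y ^ 3"
    if "y > 0" for x y
    using that by (simp add: divide_simps power2_eq_square power3_eq_cube)
  ultimately have "(e * N' * w t - e * N * (e * M / w t)) / (w t * w t) =
      (N' * metric_sq t - N * M) / w t ^ 3"
    using w_pos[OF t] by simp
  also have "\<dots> = variation \<eta> \<zeta> t
      - cosh (u t) * euler_lagrange t / w t ^ 3 * (v' t * \<eta> t - u' t * \<zeta> t)"
  proof -
    have "(A * (y\<^sup>2 * y\<^sup>2) + F * B * (e * y\<^sup>2) - C * X) / y ^ 3 =
        A * y + F * (e * B / y) - C / y ^ 3 * X" if "y > 0" for A B C F X y :: real
      using that by (simp add: divide_simps power2_eq_square power3_eq_cube) (simp add: algebra_simps)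
    from this[OF w_pos[OF t]] show ?thesis
      unfolding poly variation_def V2 unfolding V .
  qed
  finally have quotient: "(e * N' * w t - e * N * (e * M / w t)) / (w t * w t) =
    variation \<eta> \<zeta> t
      - cosh (u t) * euler_lagrange t / w t ^ 3 * (v' t * \<eta> t - u' t * \<zeta> t)" .
  have eN: "weight t * e * (v' t * (cosh (u t))\<^sup>2 * \<zeta> t - u' t * \<eta> t) = e * N"
    by (simp add: N_def)
  have "w t \<noteq> 0" using w_pos[OF t] by simp
  from DERIV_divide[OF dN dw this] show ?thesis
    unfolding eN quotient .
qed

text \<open>The momentum pairing vanishes at both end points together with \<open>\<eta>\<close> and
  \<open>\<zeta>\<close>, so by the fundamental theorem of calculus the integral of its derivative
  is 0.\<close>

lemma integral_variation:
  assumes \<eta>: "smooth a b \<eta>" and \<zeta>: "smooth a b \<zeta>"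
    and ends: "\<eta> a = 0" "\<eta> b = 0" "\<zeta> a = 0" "\<zeta> b = 0"
  shows "integral {a..b} (variation \<eta> \<zeta>) =
    integral {a..b} (\<lambda>t. cosh (u t) * euler_lagrange t / w t ^ 3 * (v' t * \<eta> t - u' t * \<zeta> t))"
proof -
  have nz: "\<forall>t\<in>{a..b}. w t \<noteq> 0" using w_pos by force
  note c = cont_uv cont_w cont_euler_lagrange \<eta>[THEN smooth_continuous_on]
    \<zeta>[THEN smooth_continuous_on] smooth_continuous_on[OF smooth_D[OF \<eta>]]
    smooth_continuous_on[OF smooth_D[OF \<zeta>]]
  have 1: "variation \<eta> \<zeta> integrable_on {a..b}"
    unfolding variation_def weight_def
    by (intro integrable_continuous_real continuous_intros c nz)
  have 2: "(\<lambda>t. cosh (u t) * euler_lagrange t / w t ^ 3 * (v' t * \<eta> t - u' t * \<zeta> t))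
      integrable_on {a..b}"
    using nz by (intro integrable_continuous_real continuous_intros c) auto
  have "((\<lambda>t. variation \<eta> \<zeta> t
      - cosh (u t) * euler_lagrange t / w t ^ 3 * (v' t * \<eta> t - u' t * \<zeta> t)) has_integral
      weight b * e * (v' b * (cosh (u b))\<^sup>2 * \<zeta> b - u' b * \<eta> b) / w b
      - weight a * e * (v' a * (cosh (u a))\<^sup>2 * \<zeta> a - u' a * \<eta> a) / w a) {a..b}"
    using ab variation_boundary_derivative[OF \<eta> \<zeta>]
    by (intro fundamental_theorem_of_calculus)
      (auto simp flip: has_real_derivative_iff_has_vector_derivative)
  with integral_diff[OF 1 2] ends show ?thesis
    by (simp add: integral_unique)
qed

text \<open>Differentiation under the integral sign, on a ball of parameters where the radicand
  stays positive and the square root is therefore differentiable.\<close>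

lemma energy_derivative:
  assumes \<eta>: "smooth a b \<eta>" and \<zeta>: "smooth a b \<zeta>"
  shows "((\<lambda>s. energy_xz e lam a b (\<lambda>t. u t + s * \<eta> t) (\<lambda>t. v t + s * \<zeta> t))
    has_real_derivative integral {a..b} (variation \<eta> \<zeta>)) (at 0)"
proof -
  \<comment> \<open>Along the variation, \<open>P\<close> is the weight and \<open>G\<close> the
    radicand. \<open>P'\<close> is the derivative of \<open>P\<close> in \<open>s\<close>, but
    \<open>G'\<close> is half that of \<open>G\<close>, so that \<open>sqrt G\<close> has derivative
    \<open>G' / sqrt G\<close>.\<close>
  define P where "P s t = cosh (u t + s * \<eta> t) * sin (v t + s * \<zeta> t) + lam" for s t
  define G where "G s t = e * ((v' t + s * D a b \<zeta> t)\<^sup>2 * (cosh (u t + s * \<eta> t))\<^sup>2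
    - (u' t + s * D a b \<eta> t)\<^sup>2)" for s t
  define P' where "P' s t = sinh (u t + s * \<eta> t) * \<eta> t * sin (v t + s * \<zeta> t)
    + cosh (u t + s * \<eta> t) * cos (v t + s * \<zeta> t) * \<zeta> t" for s t
  define G' where "G' s t = e * ((v' t + s * D a b \<zeta> t) * D a b \<zeta> t * (cosh (u t + s * \<eta> t))\<^sup>2
    + (v' t + s * D a b \<zeta> t)\<^sup>2 * cosh (u t + s * \<eta> t) * sinh (u t + s * \<eta> t) * \<eta> t
    - (u' t + s * D a b \<eta> t) * D a b \<eta> t)" for s t
  have cont: "continuous_on (W \<times> {a..b}) (\<lambda>z. f (snd z))" if "smooth a b f" for f :: "real \<Rightarrow> real" and W :: "real set"
    by (rule continuous_on_compose2[OF smooth_continuous_on[OF that]]) (auto intro: continuous_intros)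
  note c = smooth_uv(1-4)[THEN cont] \<eta>[THEN cont] \<zeta>[THEN cont]
    smooth_D[OF \<eta>, THEN cont] smooth_D[OF \<zeta>, THEN cont]
  have contG: "continuous_on (W \<times> {a..b}) (\<lambda>z. G (fst z) (snd z))" for W
    unfolding G_def by (intro continuous_intros c)
  obtain d where d: "d > 0" "\<And>s t. s \<in> ball 0 d \<Longrightarrow> t \<in> {a..b} \<Longrightarrow> G s t > 0"
  proof (rule eventually_positive_on_compact[OF contG])
    show "G (fst (0, t)) (snd (0, t)) > 0" if "t \<in> {a..b}" for t
      using pos[OF that] by (simp add: G_def)
  qed auto
  have "((\<lambda>s. integral (cbox a b) (\<lambda>t. P s t * sqrt (G s t))) has_real_derivative
      integral (cbox a b) (\<lambda>t. P' 0 t * sqrt (G 0 t) + P 0 t * (G' 0 t / sqrt (G 0 t))))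
      (at 0 within ball 0 d)"
  proof (rule leibniz_rule_field_derivative[where
        fx = "\<lambda>s t. P' s t * sqrt (G s t) + P s t * (G' s t / sqrt (G s t))"])
    fix s t assume s: "s \<in> ball (0::real) d" and t: "t \<in> cbox a b"
    have G: "G s t > 0" using d(2)[OF s] t by simp
    have "((\<lambda>s. P s t) has_real_derivative P' s t) (at s within ball 0 d)"
      unfolding P_def P'_def by (auto intro!: derivative_eq_intros)
    moreover have "((\<lambda>s. G s t) has_real_derivative 2 * G' s t) (at s within ball 0 d)"
      unfolding G_def G'_def
      by (auto intro!: derivative_eq_intros simp: algebra_simps power2_eq_square)
    ultimately show "((\<lambda>s. P s t * sqrt (G s t)) has_real_derivative
        P' s t * sqrt (G s t) + P s t * (G' s t / sqrt (G s t))) (at s within ball 0 d)"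
      using G by (auto intro!: derivative_eq_intros simp: field_simps)
  next
    fix s assume "s \<in> ball (0::real) d"
    show "(\<lambda>t. P s t * sqrt (G s t)) integrable_on cbox a b"
      unfolding P_def G_def cbox_interval
      by (intro integrable_continuous_real continuous_intros cont_uv
          \<eta>[THEN smooth_continuous_on] \<zeta>[THEN smooth_continuous_on]
          smooth_continuous_on[OF smooth_D[OF \<eta>]] smooth_continuous_on[OF smooth_D[OF \<zeta>]])
  next
    have "\<forall>z\<in>ball 0 d \<times> {a..b}. sqrt (G (fst z) (snd z)) \<noteq> 0"
      using d(2) by force
    then show "continuous_on (ball 0 d \<times> cbox a b)
        (\<lambda>(s, t). P' s t * sqrt (G s t) + P s t * (G' s t / sqrt (G s t)))"
      unfolding split_beta cbox_interval
      by (intro continuous_on_add continuous_on_mult continuous_on_divide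
          continuous_on_real_sqrt contG) (auto simp: P'_def P_def G'_def intro!: continuous_intros c)
  qed (use d in auto)
  then have "((\<lambda>s. integral {a..b} (\<lambda>t. P s t * sqrt (G s t))) has_real_derivative
      integral {a..b} (\<lambda>t. P' 0 t * sqrt (G 0 t) + P 0 t * (G' 0 t / sqrt (G 0 t)))) (at 0)"
    using d(1) by (simp add: at_within_open[of 0 "ball 0 d"])
  moreover have "integral {a..b} (\<lambda>t. P' 0 t * sqrt (G 0 t) + P 0 t * (G' 0 t / sqrt (G 0 t)))
      = integral {a..b} (variation \<eta> \<zeta>)"
    by (intro integral_cong)
      (simp add: variation_def P_def P'_def G_def G'_def w_def metric_sq_def weight_def)
  moreover have "energy_xz e lam a b (\<lambda>t. u t + s * \<eta> t) (\<lambda>t. v t + s * \<zeta> t) =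
      integral {a..b} (\<lambda>t. P s t * sqrt (G s t))" for s
    unfolding energy_xz_def
  proof (intro integral_cong)
    fix t assume t: "t \<in> {a..b}"
    have "D a b (\<lambda>t. f t + s * g t) t = D a b f t + s * D a b g t"
      if "smooth a b f" "smooth a b g" for f g
      using that[THEN real_derivative_D, OF t]
      by (intro D_eq[OF ab t])
        (auto intro!: derivative_eq_intros simp flip: has_real_derivative_iff_has_vector_derivative)
    then show "(cosh (u t + s * \<eta> t) * sin (v t + s * \<zeta> t) + lam) *
        sqrt (e * ((D a b (\<lambda>t. v t + s * \<zeta> t) t)\<^sup>2 * (cosh (u t + s * \<eta> t))\<^sup>2 -
          (D a b (\<lambda>t. u t + s * \<eta> t) t)\<^sup>2)) = P s t * sqrt (G s t)"
      using \<eta> \<zeta> smooth_u smooth_v by (simp add: P_def G_def)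
  qed
  ultimately show ?thesis by simp
qed

section \<open>The Euler-Lagrange equation of the energy\<close>

lemma euler_lagrange_zero:
  assumes stationary: "\<And>\<eta> \<zeta>. smooth a b \<eta> \<Longrightarrow> smooth a b \<zeta> \<Longrightarrow>
      \<eta> a = 0 \<Longrightarrow> \<eta> b = 0 \<Longrightarrow> \<zeta> a = 0 \<Longrightarrow> \<zeta> b = 0 \<Longrightarrow>
      integral {a..b} (variation \<eta> \<zeta>) = 0"
    and t: "t \<in> {a..b}"
  shows "euler_lagrange t = 0"
proof -
  \<comment> \<open>The factor \<open>(t - a) * (b - t)\<close> vanishes at the end points and is
    positive between them. Below, \<open>- u'\<close> is written \<open>0 - u'\<close> to fit the
    rules of \<open>smooth_closure\<close>.\<close>
  define \<eta> where "\<eta> t = (t - a) * (b - t) * (euler_lagrange t * v' t)" for t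
  define \<zeta> where "\<zeta> t = (t - a) * (b - t) * (euler_lagrange t * (0 - u' t))" for t
  have "\<eta> \<in> smooth_closure a b" "\<zeta> \<in> smooth_closure a b"
    unfolding \<eta>_def \<zeta>_def
    by (intro smooth_closure.intros(2-) smooth_uv[THEN smooth_closure.base]
        smooth_euler_lagrange[THEN smooth_closure.base])+
  then have sm: "smooth a b \<eta>" "smooth a b \<zeta>"
    using smooth_closure_smooth[OF ab] by blast+
  have ends: "\<eta> a = 0" "\<eta> b = 0" "\<zeta> a = 0" "\<zeta> b = 0"
    by (auto simp: \<eta>_def \<zeta>_def)
  define g where "g t = cosh (u t) / w t ^ 3 * ((t - a) * (b - t)) *
    ((euler_lagrange t)\<^sup>2 * ((v' t)\<^sup>2 + (u' t)\<^sup>2))" for t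
  have "v' t * \<eta> t - u' t * \<zeta> t =
      (t - a) * (b - t) * (euler_lagrange t * ((v' t)\<^sup>2 + (u' t)\<^sup>2))" for t
    unfolding \<eta>_def \<zeta>_def by algebra
  then have "(\<lambda>t. cosh (u t) * euler_lagrange t / w t ^ 3 * (v' t * \<eta> t - u' t * \<zeta> t)) = g"
    by (simp add: fun_eq_iff g_def power2_eq_square[of "euler_lagrange _"])
  with stationary[OF sm ends] integral_variation[OF sm ends] have "integral {a..b} g = 0"
    by simp
  moreover have "continuous_on {a..b} g"
    unfolding g_def using w_pos
    by (intro continuous_intros cont_uv cont_w cont_euler_lagrange) force
  moreover have "g t \<ge> 0" if "t \<in> {a..b}" for t
    using w_pos[OF that] that by (simp add: g_def)
  ultimately have g0: "\<forall>t\<in>{a..b}. g t = 0"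
    using integral_eq_0_iff[of a b g] ab by simp
  \<comment> \<open>In the interior every other factor of \<open>g\<close> is nonzero; in particular
    \<open>u'\<close> and \<open>v'\<close> cannot both vanish, by \<open>pos\<close>. Continuity
    then extends the result to the end points.\<close>
  have "euler_lagrange t = 0" if "t \<in> {a<..<b}" for t
  proof -
    have t: "t \<in> {a..b}" using that by simp
    have "(v' t)\<^sup>2 + (u' t)\<^sup>2 \<noteq> 0"
      using pos[OF t] by (auto simp: sum_power2_eq_zero_iff)
    with g0 t that w_pos[OF t] show ?thesis by (auto simp: g_def)
  qed
  then show ?thesis
    using continuous_constant_on_closure[of "{a<..<b}" euler_lagrange 0 t]
      cont_euler_lagrange ab t by simp
qed

text \<open>By uniqueness of derivatives, being a catenary forces the integral of
  \<open>variation\<close> to vanish for all admissible test functions; conversely, if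
  \<open>euler_lagrange\<close> is 0, so is the integral in
  \<open>integral_variation\<close>.\<close>

lemma catenary_iff_euler_lagrange:
  assumes "causal_sign a b (\<lambda>t. Psi (u t) (v t)) = e"
  shows "catenary_xz lam a b u v \<longleftrightarrow> (\<forall>t\<in>{a..b}. euler_lagrange t = 0)"
proof
  assume "catenary_xz lam a b u v"
  then show "\<forall>t\<in>{a..b}. euler_lagrange t = 0"
    unfolding catenary_xz_def assms
    by (intro ballI euler_lagrange_zero DERIV_unique[OF energy_derivative]) auto
next
  assume "\<forall>t\<in>{a..b}. euler_lagrange t = 0"
  then have "integral {a..b}
      (\<lambda>t. cosh (u t) * euler_lagrange t / w t ^ 3 * (v' t * \<eta> t - u' t * \<zeta> t)) =
      integral {a..b} (\<lambda>_. 0)" for \<eta> \<zeta>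
    by (intro integral_cong) simp
  then have zero: "integral {a..b} (variation \<eta> \<zeta>) = 0"
    if "smooth a b \<eta>" "smooth a b \<zeta>" "\<eta> a = 0" "\<eta> b = 0" "\<zeta> a = 0" "\<zeta> b = 0" for \<eta> \<zeta>
    using integral_variation[OF that] by simp
  show "catenary_xz lam a b u v"
    unfolding catenary_xz_def assms
  proof (intro allI impI, elim conjE)
    fix \<eta> \<zeta> :: "real \<Rightarrow> real"
    assume *: "smooth a b \<eta>" "smooth a b \<zeta>" "\<eta> a = 0" "\<eta> b = 0" "\<zeta> a = 0" "\<zeta> b = 0"
    show "((\<lambda>s. energy_xz e lam a b (\<lambda>t. u t + s * \<eta> t) (\<lambda>t. v t + s * \<zeta> t))
        has_real_derivative 0) (at 0)"
      using energy_derivative[OF *(1,2)] unfolding zero[OF *] .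
  qed
qed

section \<open>Curvature and principal normal in coordinates\<close>

lemma D_D_Psi:
  assumes "t \<in> {a..b}"
  shows "D a b (D a b (\<lambda>t. Psi (u t) (v t))) t =
    vector [cosh (u t) * (u' t)\<^sup>2 * cos (v t) + sinh (u t) * u'' t * cos (v t)
        - 2 * sinh (u t) * u' t * sin (v t) * v' t
        - cosh (u t) * cos (v t) * (v' t)\<^sup>2 - cosh (u t) * sin (v t) * v'' t,
      cosh (u t) * (u' t)\<^sup>2 * sin (v t) + sinh (u t) * u'' t * sin (v t)
        + 2 * sinh (u t) * u' t * cos (v t) * v' t
        - cosh (u t) * sin (v t) * (v' t)\<^sup>2 + cosh (u t) * cos (v t) * v'' t,
      sinh (u t) * (u' t)\<^sup>2 + cosh (u t) * u'' t]"
  using smooth_uv(1-4)[THEN real_derivative_D, OF assms]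
  by (intro D_eq[OF ab assms] Psi_tangent_derivative
      has_vector_derivative_transform[OF assms D_Psi[OF ab smooth_u smooth_v]])

lemma speed_Psi:
  assumes "causal_sign a b (\<lambda>t. Psi (u t) (v t)) = e" "t \<in> {a..b}"
  shows "speed a b (\<lambda>t. Psi (u t) (v t)) t = w t"
  by (simp add: speed_def w_def metric_sq_def linner_D_Psi[OF ab smooth_u smooth_v assms(2)] assms(1))

lemma curvature_Psi:
  assumes "causal_sign a b (\<lambda>t. Psi (u t) (v t)) = e" "t \<in> {a..b}"
  shows "curvature a b (\<lambda>t. Psi (u t) (v t)) t = e * (curv_det t / w t ^ 3)"
proof -
  \<comment> \<open>The factors equal to 1 by the Pythagorean and hyperbolic identities are left
    standing, which makes this a polynomial identity; the deleted simp rules would collapse the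
    trigonometric one too early.\<close>
  have "linner (D a b (D a b (\<lambda>t. Psi (u t) (v t))) t)
      (lcross (D a b (\<lambda>t. Psi (u t) (v t)) t) (xi (Psi (u t) (v t)))) =
      ((sin (v t))\<^sup>2 + (cos (v t))\<^sup>2) * (((cosh (u t))\<^sup>2 - (sinh (u t))\<^sup>2) *
        ((u'' t * v' t - u' t * v'' t) * cosh (u t) - 2 * (u' t)\<^sup>2 * v' t * sinh (u t))
        + v' t ^ 3 * (cosh (u t))\<^sup>2 * sinh (u t))"
    unfolding D_D_Psi[OF assms(2)] D_Psi[OF ab smooth_u smooth_v assms(2)]
    unfolding linner_def lcross_def xi_def Psi_def cross3_def vector_3 vector_uminus_component
    by (simp add: algebra_simps power2_eq_square power3_eq_cube
        del: sin_cos_squared_add sin_cos_squared_add2 sin_cos_squared_add3)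
  also have "\<dots> = curv_det t"
    by (simp add: curv_det_def cosh_square_eq)
  finally show ?thesis by (simp add: curvature_def speed_Psi[OF assms] assms(1))
qed

lemma principal_normal_Psi:
  assumes "causal_sign a b (\<lambda>t. Psi (u t) (v t)) = e" "t \<in> {a..b}"
  shows "linner (principal_normal a b (\<lambda>t. Psi (u t) (v t)) t) Yvec = normal_Y t / w t"
proof -
  \<comment> \<open>Pairing with \<open>Yvec\<close> picks out the second coordinate.\<close>
  have "lcross (xi (Psi (u t) (v t))) (D a b (\<lambda>t. Psi (u t) (v t)) t) $ 2 =
      ((cosh (u t))\<^sup>2 - (sinh (u t))\<^sup>2) * (cos (v t) * u' t)
        + sinh (u t) * cosh (u t) * sin (v t) * v' t"
    unfolding D_Psi[OF ab smooth_u smooth_v assms(2)]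
    unfolding lcross_def xi_def Psi_def cross3_def vector_3 vector_uminus_component
    by (simp add: algebra_simps power2_eq_square)
  then show ?thesis
    by (simp add: principal_normal_def speed_Psi[OF assms] linner_def Yvec_def axis_def normal_Y_def
        add.commute cosh_square_eq)
qed

end

section \<open>The curvature characterization of catenaries\<close>

theorem theorem3p2:
  fixes a b lam :: real and u v :: "real \<Rightarrow> real" and \<gamma> :: "real \<Rightarrow> real ^ 3"
  assumes "a < b"
    and "smooth a b u" and "smooth a b v"
    and "\<gamma> = (\<lambda>t. Psi (u t) (v t))"
    and "nondegenerate a b \<gamma>"
    and "\<forall>t\<in>{a..b}. \<gamma> t \<in> dS2_xz_pos"
    and "\<forall>t\<in>{a..b}. dist_xz (\<gamma> t) + lam \<noteq> 0"
  shows "catenary_xz lam a b u v \<longleftrightarrow>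
    (\<forall>t\<in>{a..b}. curvature a b \<gamma> t =
        - (linner (principal_normal a b \<gamma> t) Yvec / (dist_xz (\<gamma> t) + lam)))"
proof -
  define e where "e = causal_sign a b \<gamma>"
  have e: "e * e = 1" by (simp add: e_def causal_sign_def)
  \<comment> \<open>When the curve is not spacelike, \<open>causal_sign\<close> is
    \<open>- 1\<close> by default, and non-degeneracy makes the curve timelike.\<close>
  have "e * linner (D a b \<gamma> t) (D a b \<gamma> t) > 0" if "t \<in> {a..b}" for t
    using assms(5) that
    by (auto simp: e_def causal_sign_def nondegenerate_def spacelike_def timelike_def)
  then interpret nondegenerate_lift a b lam e u v
    using assms(1-3) e linner_D_Psi[OF assms(1-3)] by unfold_locales (auto simp: assms(4))
  have sgn: "causal_sign a b (\<lambda>t. Psi (u t) (v t)) = e"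
    by (simp add: e_def assms(4))
  have "curvature a b \<gamma> t = - (linner (principal_normal a b \<gamma> t) Yvec / (dist_xz (\<gamma> t) + lam))
      \<longleftrightarrow> euler_lagrange t = 0" if t: "t \<in> {a..b}" for t
  proof -
    have F: "weight t \<noteq> 0" "dist_xz (\<gamma> t) + lam = weight t"
      using assms(4,7) t by (auto simp: weight_def dist_xz_def Psi_def)
    \<comment> \<open>Both sides are multiplied by \<open>weight t * w t ^ 3\<close>, which is
      nonzero. Replacing \<open>(w t)\<^sup>2\<close> by \<open>e * metric_sq t\<close> then turns
      the sum into \<open>e * euler_lagrange t\<close>.\<close>
    have "e * (curv_det t / w t ^ 3) = - (normal_Y t / w t / weight t) \<longleftrightarrow>
        e * curv_det t * weight t + normal_Y t * (w t)\<^sup>2 = 0"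
      using w_pos[OF t] F(1) by (auto simp: field_simps power2_eq_square power3_eq_cube)
    also have "\<dots> \<longleftrightarrow> e * euler_lagrange t = 0"
      by (simp add: w_sq[OF t] euler_lagrange_def algebra_simps)
    also have "\<dots> \<longleftrightarrow> euler_lagrange t = 0"
      using e by auto
    finally show ?thesis
      unfolding F(2) unfolding assms(4) curvature_Psi[OF sgn t] principal_normal_Psi[OF sgn t] .
  qed
  with catenary_iff_euler_lagrange[OF sgn] show ?thesis by blast
qed

end
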